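(* Let $\Theta_1,\dots,\Theta_r$ be constant-free bracket forms and let $\delta>0$. Then there exist $N_0$ and $c>0$, depending only on $\Theta_1,\dots,\Theta_r$ and $\delta$, such that for all $N\ge N_0$ and all realisations $\theta_1,\dots,\theta_r$ of $\Theta_1,\dots,\Theta_r$ respectively, we have \[|\{n\in[N]:\{\theta_i(n)\}\in(-\delta,\delta)\text{ for all }i=1,\dots,r\}|\ge cN.\]
   Context: Notation: $[N]=\{1,\dots,N\}$, and for $x\in\mathbb{R}$, $\{x\}$ denotes the fractional part of $x$ chosen to lie in $(-1/2,1/2]$. Polynomial forms: fix an alphabet of symbols $\alpha_1,\alpha_2,\dots$. A monomial form is a formal expression $\pm\alpha_{i_1}\cdots\alpha_{i_t}n^j$ ($t\ge0$, $j\ge0$); it has degree $j$, and is constant-free if $j\ge1$. A polynomial form of degree at most $k$ is a formal finite sum of monomial forms of degree at most $k$; it is constant-free if all its monomial forms are. Bracket forms are formal expressions defined recursively: a polynomial form of degree at most $k$ is a bracket form of degree at most $k$; if $\Phi$ is a bracket form of degree at most $k$ then so are $-\Phi$ and $\{\Phi\}$; if $\Phi_1,\Phi_2$ are bracket forms of degree at most $k_1,k_2$ then $\Phi_1\cdot\Phi_2$ is a bracket form of degree at most $k_1+k_2$ and $\Phi_1+\Phi_2$ is a bracket form of degree at most $\max\{k_1,k_2\}$. A bracket form is constant-free if all polynomial forms used in its construction are constant-free. A realisation of a bracket form is the function of $n$ obtained by replacing each symbol $\alpha_i$ by a real number (the same for every occurrence of $\alpha_i$), with $\{\cdot\}$ interpreted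 as fractional part. *)

theory Defs
  imports Complex_Main
begin

definition cfrac :: "real \<Rightarrow> real" where
  "cfrac x = x - of_int \<lceil>x - 1/2\<rceil>"

lemma cfrac_unique: "cfrac x = y \<longleftrightarrow> y \<in> {-1/2<..1/2} \<and> x - y \<in> \<int>"
proof
  assume "cfrac x = y"
  then have y: "y = x - of_int \<lceil>x - 1/2\<rceil>" by (simp add: cfrac_def)
  then have "-1/2 < y" "y \<le> 1/2"
    using ceiling_correct[of "x - 1/2"] by linarith+
  moreover from y have "x - y \<in> \<int>" by simp
  ultimately show "y \<in> {-1/2<..1/2} \<and> x - y \<in> \<int>" by simp
next
  assume y: "y \<in> {-1/2<..1/2} \<and> x - y \<in> \<int>"
  then obtain m :: int where "x - y = of_int m" by (auto elim: Ints_cases)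
  moreover from this y have "\<lceil>x - 1/2\<rceil> = m"
    by (intro ceiling_unique) auto
  ultimately show "cfrac x = y" by (simp add: cfrac_def)
qed

datatype sign = Pos | Neg

text \<open>\<open>Monomial s [i\<^sub>1, \<dots>, i\<^sub>t] j\<close> is the formal expression
  \<open>\<plusminus>\<alpha>\<^bsub>i\<^sub>1\<^esub>\<cdots>\<alpha>\<^bsub>i\<^sub>t\<^esub> n\<^sup>j\<close>.  A polynomial form is a
  formal finite sum, represented by the list of its summands.\<close>

datatype monomial_form = Monomial (mono_sign: sign) (mono_symbols: "nat list") (mono_degree: nat)

type_synonym polynomial_form = "monomial_form list"

datatype bracket_form =
    BPoly polynomial_form
  | BNeg bracket_form
  | BFrac bracket_form
  | BMult bracket_form bracket_form
  | BAdd bracket_form bracket_form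

inductive degree_at_most :: "nat \<Rightarrow> bracket_form \<Rightarrow> bool" where
  "(\<forall>m \<in> set p. mono_degree m \<le> k) \<Longrightarrow> degree_at_most k (BPoly p)"
| "degree_at_most k \<Phi> \<Longrightarrow> degree_at_most k (BNeg \<Phi>)"
| "degree_at_most k \<Phi> \<Longrightarrow> degree_at_most k (BFrac \<Phi>)"
| "degree_at_most k\<^sub>1 \<Phi>\<^sub>1 \<Longrightarrow> degree_at_most k\<^sub>2 \<Phi>\<^sub>2 \<Longrightarrow>
     degree_at_most (k\<^sub>1 + k\<^sub>2) (BMult \<Phi>\<^sub>1 \<Phi>\<^sub>2)"
| "degree_at_most k\<^sub>1 \<Phi>\<^sub>1 \<Longrightarrow> degree_at_most k\<^sub>2 \<Phi>\<^sub>2 \<Longrightarrow>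
     degree_at_most (max k\<^sub>1 k\<^sub>2) (BAdd \<Phi>\<^sub>1 \<Phi>\<^sub>2)"

text \<open>Every term of the datatype is a bracket form of degree at most \<open>k\<close> for some \<open>k\<close>, so a
  bracket form of unspecified degree is just an element of \<^typ>\<open>bracket_form\<close>.\<close>

lemma ex_degree_at_most: "\<exists>k. degree_at_most k \<Phi>"
proof (induction \<Phi>)
  case (BPoly p)
  have "\<forall>m \<in> set p. mono_degree m \<le> (\<Sum>m \<in> set p. mono_degree m)"
    by (simp add: member_le_sum)
  then show ?case by (blast intro: degree_at_most.intros)
qed (blast intro: degree_at_most.intros)+

primrec constant_free :: "bracket_form \<Rightarrow> bool" where
  "constant_free (BPoly p) \<longleftrightarrow> (\<forall>m \<in> set p. mono_degree m \<ge> 1)"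
| "constant_free (BNeg \<Phi>) \<longleftrightarrow> constant_free \<Phi>"
| "constant_free (BFrac \<Phi>) \<longleftrightarrow> constant_free \<Phi>"
| "constant_free (BMult \<Phi>\<^sub>1 \<Phi>\<^sub>2) \<longleftrightarrow> constant_free \<Phi>\<^sub>1 \<and> constant_free \<Phi>\<^sub>2"
| "constant_free (BAdd \<Phi>\<^sub>1 \<Phi>\<^sub>2) \<longleftrightarrow> constant_free \<Phi>\<^sub>1 \<and> constant_free \<Phi>\<^sub>2"

primrec sign_value :: "sign \<Rightarrow> real" where
  "sign_value Pos = 1"
| "sign_value Neg = -1"

definition realise_monomial :: "(nat \<Rightarrow> real) \<Rightarrow> monomial_form \<Rightarrow> nat \<Rightarrow> real" where
  "realise_monomial \<alpha> m n =
     sign_value (mono_sign m) * (\<Prod>i\<leftarrow>mono_symbols m. \<alpha> i) * real n ^ mono_degree m"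

primrec realise :: "(nat \<Rightarrow> real) \<Rightarrow> bracket_form \<Rightarrow> nat \<Rightarrow> real" where
  "realise \<alpha> (BPoly p) n = (\<Sum>m\<leftarrow>p. realise_monomial \<alpha> m n)"
| "realise \<alpha> (BNeg \<Phi>) n = - realise \<alpha> \<Phi> n"
| "realise \<alpha> (BFrac \<Phi>) n = cfrac (realise \<alpha> \<Phi> n)"
| "realise \<alpha> (BMult \<Phi>\<^sub>1 \<Phi>\<^sub>2) n = realise \<alpha> \<Phi>\<^sub>1 n * realise \<alpha> \<Phi>\<^sub>2 n"
| "realise \<alpha> (BAdd \<Phi>\<^sub>1 \<Phi>\<^sub>2) n = realise \<alpha> \<Phi>\<^sub>1 n + realise \<alpha> \<Phi>\<^sub>2 n"

definition is_realisation :: "bracket_form \<Rightarrow> (nat \<Rightarrow> real) \<Rightarrow> bool" where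
  "is_realisation \<Phi> \<phi> \<longleftrightarrow> (\<exists>\<alpha>. \<phi> = realise \<alpha> \<Phi>)"

end

theory Submission
  imports Defs "HOL-Library.FuncSet"
begin

text \<open>Regard \<open>n\<close> as a function \<open>n\<^sub>F = d |F|\<close> of a finite set \<open>F \<subseteq> {0, \<dots>, K - 1}\<close>; a constant-free
  polynomial in \<open>n\<close> is then a polynomial set function vanishing at \<open>\<emptyset>\<close>. Finitely many polynomial set
  functions are simultaneously close to integers on all unions of suitable disjoint blocks; this is
  shown by induction on the degree, choosing blocks along which the functions are almost additive
  modulo 1 and applying the pigeonhole principle to partial sums. Where a polynomial set function \<open>f\<close>
  is that close to integers, the fractional part \<open>{f}\<close> is itself a polynomial set function of the
  same degree. So every bracket form becomes a polynomial set function on the unions of suitable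
  blocks, and one more application of recurrence gives some \<open>m \<le> K\<close>, with \<open>K\<close> independent of \<open>d\<close> and
  of the realisation, such that \<open>n = d m\<close> is good. Varying \<open>d \<le> N / K\<close> gives a positive proportion.\<close>

section \<open>Distance to the nearest integer\<close>

lemma abs_cfrac_le_half: "\<bar>cfrac x\<bar> \<le> 1/2"
  using cfrac_unique[of x "cfrac x"] by auto

lemma cfrac_diff_Ints: "x - cfrac x \<in> \<int>"
  using cfrac_unique[of x "cfrac x"] by auto

lemma cfrac_eqI: "\<bar>y\<bar> < 1/2 \<Longrightarrow> x - y \<in> \<int> \<Longrightarrow> cfrac x = y"
  by (auto simp: cfrac_unique)

text \<open>A representative below 1/2 in absolute value is \<open>cfrac x\<close> itself, and any
  other is at least 1/2, which already bounds \<open>cfrac x\<close>.\<close>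

lemma abs_cfrac_le:
  assumes "x - y \<in> \<int>"
  shows "\<bar>cfrac x\<bar> \<le> \<bar>y\<bar>"
proof (cases "\<bar>y\<bar> < 1/2")
  case True
  then show ?thesis using cfrac_eqI[OF True assms] by simp
next
  case False
  then show ?thesis using abs_cfrac_le_half[of x] by linarith
qed

text \<open>Triangle inequality for the distance to the nearest integer. All later error estimates
  rest on it.\<close>

lemma abs_cfrac_add_le: "\<bar>cfrac (x + y)\<bar> \<le> \<bar>cfrac x\<bar> + \<bar>cfrac y\<bar>"
proof -
  have "(x - cfrac x) + (y - cfrac y) \<in> \<int>"
    by (intro Ints_add cfrac_diff_Ints)
  then have "x + y - (cfrac x + cfrac y) \<in> \<int>"
    by (simp add: algebra_simps)
  then show ?thesis using abs_cfrac_le[of "x + y" "cfrac x + cfrac y"] by linarith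
qed

lemma cfrac_0 [simp]: "cfrac 0 = 0"
  by (simp add: cfrac_unique)

section \<open>Polynomial set functions\<close>

text \<open>For finite \<open>A\<close> these are the functions f(F) = sum of c(S) over the nonempty
  S contained in F with at most d elements. Subtracting \<open>f G\<close> as well as
  \<open>f F\<close> keeps the difference in the class of functions that vanish at the empty set,
  and restricting \<open>G\<close> to \<open>A - F\<close> means that only disjoint unions are ever
  formed. Degree 1 is additivity on disjoint sets.\<close>

primrec set_poly :: "nat \<Rightarrow> nat set \<Rightarrow> (nat set \<Rightarrow> real) \<Rightarrow> bool" where
  "set_poly 0 A f \<longleftrightarrow> (\<forall>F\<subseteq>A. f F = 0)"
| "set_poly (Suc d) A f \<longleftrightarrow> (\<forall>F\<subseteq>A. set_poly d (A - F) (\<lambda>G. f (F \<union> G) - f F - f G))"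

declare set_poly.simps(2) [simp del]

section \<open>Restriction, extensionality and change of degree\<close>

lemma set_polyD:
  "set_poly (Suc d) A f \<Longrightarrow> F \<subseteq> A \<Longrightarrow> set_poly d (A - F) (\<lambda>G. f (F \<union> G) - f F - f G)"
  by (simp add: set_poly.simps(2))

lemma set_poly_subset: "set_poly d A f \<Longrightarrow> A' \<subseteq> A \<Longrightarrow> set_poly d A' f"
proof (induction d arbitrary: A A' f)
  case (Suc d)
  show ?case
    unfolding set_poly.simps
  proof (intro allI impI)
    fix F assume "F \<subseteq> A'"
    then have "set_poly d (A - F) (\<lambda>G. f (F \<union> G) - f F - f G)" "A' - F \<subseteq> A - F"
      using Suc.prems set_polyD by auto
    then show "set_poly d (A' - F) (\<lambda>G. f (F \<union> G) - f F - f G)"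
      by (rule Suc.IH)
  qed
qed auto

lemma set_poly_cong: "set_poly d A f \<Longrightarrow> (\<And>F. F \<subseteq> A \<Longrightarrow> f F = g F) \<Longrightarrow> set_poly d A g"
proof (induction d arbitrary: A f g)
  case (Suc d)
  show ?case
    unfolding set_poly.simps
  proof (intro allI impI)
    fix F assume F: "F \<subseteq> A"
    show "set_poly d (A - F) (\<lambda>G. g (F \<union> G) - g F - g G)"
    proof (rule Suc.IH)
      show "set_poly d (A - F) (\<lambda>G. f (F \<union> G) - f F - f G)"
        using Suc.prems(1) F by (rule set_polyD)
      fix G assume "G \<subseteq> A - F"
      then have "F \<union> G \<subseteq> A" "G \<subseteq> A" using F by auto
      then show "f (F \<union> G) - f F - f G = g (F \<union> G) - g F - g G"
        using Suc.prems(2) F by metis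
    qed
  qed
qed auto

lemma set_poly_zero: "set_poly d A (\<lambda>_. 0)"
  by (induction d arbitrary: A) (auto simp: set_poly.simps)

lemma set_poly_empty: "set_poly d A f \<Longrightarrow> f {} = 0"
proof (induction d arbitrary: A f)
  case (Suc d)
  \<comment> \<open>The difference along the empty set is the constant \<open>- f {}\<close>, to
    which the induction hypothesis applies.\<close>
  have "set_poly d (A - {}) (\<lambda>G. f ({} \<union> G) - f {} - f G)"
    by (rule set_polyD[OF Suc.prems]) simp
  from Suc.IH[OF this] show ?case by simp
qed auto

lemma set_poly_Suc: "set_poly d A f \<Longrightarrow> set_poly (Suc d) A f"
proof (induction d arbitrary: A f)
  case 0
  then have "f (F \<union> G) - f F - f G = 0" if "F \<subseteq> A" "G \<subseteq> A - F" for F G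
  proof -
    have "F \<union> G \<subseteq> A" "G \<subseteq> A" using that by auto
    then show ?thesis using 0 that by simp
  qed
  then show ?case by (simp add: set_poly.simps)
next
  case (Suc d)
  show ?case
    unfolding set_poly.simps(2)[of "Suc d"] using Suc set_polyD by blast
qed

lemma set_poly_mono: "set_poly d A f \<Longrightarrow> d \<le> e \<Longrightarrow> set_poly e A f"
  by (induction e) (auto simp: le_Suc_eq intro: set_poly_Suc)

section \<open>Closure under algebraic operations\<close>

lemma set_poly_add: "set_poly d A f \<Longrightarrow> set_poly d A g \<Longrightarrow> set_poly d A (\<lambda>F. f F + g F)"
proof (induction d arbitrary: A f g)
  case (Suc d)
  show ?case
    unfolding set_poly.simps
  proof (intro allI impI)
    fix F assume F: "F \<subseteq> A"
    have "set_poly d (A - F) (\<lambda>G. (f (F \<union> G) - f F - f G) + (g (F \<union> G) - g F - g G))"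
      using Suc.IH[OF set_polyD[OF Suc.prems(1) F] set_polyD[OF Suc.prems(2) F]] .
    then show "set_poly d (A - F) (\<lambda>G. f (F \<union> G) + g (F \<union> G) - (f F + g F) - (f G + g G))"
      by (rule set_poly_cong) simp
  qed
qed auto

lemma set_poly_cmult: "set_poly d A f \<Longrightarrow> set_poly d A (\<lambda>F. c * f F)"
proof (induction d arbitrary: A f)
  case (Suc d)
  show ?case
    unfolding set_poly.simps
  proof (intro allI impI)
    fix F assume F: "F \<subseteq> A"
    have "set_poly d (A - F) (\<lambda>G. c * (f (F \<union> G) - f F - f G))"
      using Suc.IH[OF set_polyD[OF Suc.prems F]] .
    then show "set_poly d (A - F) (\<lambda>G. c * f (F \<union> G) - c * f F - c * f G)"
      by (rule set_poly_cong) (simp add: algebra_simps)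
  qed
qed auto

text \<open>Writing f(F \<union> G) = f(F) + f(G) + \<Delta>f(G), and likewise for g, expands the
  product at F \<union> G into nine terms. The difference operator removes f(F)g(F) and f(G)g(G),
  and each of the other seven has degree below d + e, by the induction hypothesis on the sum of the
  degrees where both factors vary with G.\<close>

lemma set_poly_mult:
  "set_poly d A f \<Longrightarrow> set_poly e A g \<Longrightarrow> set_poly (d + e) A (\<lambda>F. f F * g F)"
proof (induction "d + e" arbitrary: d e A f g rule: less_induct)
  case less
  show ?case
  proof (cases "d = 0 \<or> e = 0")
    case True
    then have "\<forall>F\<subseteq>A. f F * g F = 0" using less.prems by auto
    then show ?thesis
      using set_poly_cong[OF set_poly_zero, of A "\<lambda>F. f F * g F" "d + e"] by auto
  next
    case False
    then obtain d' e' where de: "d = Suc d'" "e = Suc e'" by (meson not0_implies_Suc)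
    show ?thesis
      unfolding de add_Suc set_poly.simps(2)[of "d' + Suc e'"]
    proof (intro allI impI)
      fix F assume F: "F \<subseteq> A"
      define \<Delta>f where "\<Delta>f G = f (F \<union> G) - f F - f G" for G
      define \<Delta>g where "\<Delta>g G = g (F \<union> G) - g F - g G" for G
      have sub: "A - F \<subseteq> A" by auto
      have f: "set_poly (Suc d') (A - F) f" and g: "set_poly (Suc e') (A - F) g"
        using less.prems set_poly_subset[OF _ sub] unfolding de by blast+
      have \<Delta>f: "set_poly d' (A - F) \<Delta>f" and \<Delta>g: "set_poly e' (A - F) \<Delta>g"
        using less.prems F unfolding de \<Delta>f_def \<Delta>g_def using set_polyD by blast+
      have "set_poly (d' + Suc e') (A - F) (\<lambda>G. f F * g G)"
        using set_poly_mono[OF set_poly_cmult[OF g]] by simp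
      moreover have "set_poly (d' + Suc e') (A - F) (\<lambda>G. g F * f G)"
        using set_poly_mono[OF set_poly_cmult[OF f]] by simp
      moreover have "set_poly (d' + Suc e') (A - F) (\<lambda>G. f F * \<Delta>g G)"
        using set_poly_mono[OF set_poly_cmult[OF \<Delta>g]] by simp
      moreover have "set_poly (d' + Suc e') (A - F) (\<lambda>G. g F * \<Delta>f G)"
        using set_poly_mono[OF set_poly_cmult[OF \<Delta>f]] by simp
      moreover have "set_poly (d' + Suc e') (A - F) (\<lambda>G. \<Delta>f G * g G)"
        using less.hyps[OF _ \<Delta>f g] de by simp
      moreover have "set_poly (d' + Suc e') (A - F) (\<lambda>G. f G * \<Delta>g G)"
        using less.hyps[OF _ f \<Delta>g] de by simp
      moreover have "set_poly (d' + Suc e') (A - F) (\<lambda>G. \<Delta>f G * \<Delta>g G)"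
        using set_poly_mono[OF less.hyps[OF _ \<Delta>f \<Delta>g], of "d' + Suc e'"] de by simp
      ultimately have "set_poly (d' + Suc e') (A - F) (\<lambda>G. f F * g G + g F * f G
          + f F * \<Delta>g G + g F * \<Delta>f G + \<Delta>f G * g G + f G * \<Delta>g G + \<Delta>f G * \<Delta>g G)"
        by (intro set_poly_add)
      then show "set_poly (d' + Suc e') (A - F) (\<lambda>G. f (F \<union> G) * g (F \<union> G) - f F * g F - f G * g G)"
        by (rule set_poly_cong) (simp add: \<Delta>f_def \<Delta>g_def algebra_simps)
    qed
  qed
qed

text \<open>The increment is the difference, of lower degree, plus \<open>f\<close> itself, so the
  degree is not raised. It is the quantity that telescopes when blocks are adjoined one at a
  time.\<close>

lemma set_poly_shift:
  assumes "set_poly d A f" "F \<subseteq> A"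
  shows "set_poly d (A - F) (\<lambda>G. f (F \<union> G) - f F)"
proof (cases d)
  case 0
  have "f (F \<union> G) - f F = 0" if "G \<subseteq> A - F" for G
  proof -
    have "F \<union> G \<subseteq> A" using that assms by auto
    then show ?thesis using 0 assms by simp
  qed
  then show ?thesis using 0 by simp
next
  case (Suc d')
  have "set_poly d (A - F) (\<lambda>G. f (F \<union> G) - f F - f G)"
    using assms Suc set_poly_Suc set_polyD by blast
  moreover have "set_poly d (A - F) f"
    using assms(1) by (rule set_poly_subset) auto
  ultimately have "set_poly d (A - F) (\<lambda>G. (f (F \<union> G) - f F - f G) + f G)"
    by (rule set_poly_add)
  then show ?thesis by simp
qed

text \<open>If three values are close enough to integers, taking \<open>cfrac\<close> commutes with
  the difference f(F \<union> G) - f(F) - f(G), so differences of \<open>cfrac f\<close> are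
  \<open>cfrac\<close> of differences of \<open>f\<close>. Each difference triples the error, hence
  the factor 3^d; the 2 keeps every error below 1/2.\<close>

lemma set_poly_cfrac:
  assumes "set_poly d A f" "\<And>F. F \<subseteq> A \<Longrightarrow> \<bar>cfrac (f F)\<bar> < 1 / (2 * 3 ^ d)"
  shows "set_poly d A (\<lambda>F. cfrac (f F))"
  using assms
proof (induction d arbitrary: A f)
  case (Suc d)
  show ?case
    unfolding set_poly.simps
  proof (intro allI impI)
    fix F assume F: "F \<subseteq> A"
    have eq: "cfrac (f (F \<union> G) - f F - f G) = cfrac (f (F \<union> G)) - cfrac (f F) - cfrac (f G)"
      and small: "\<bar>cfrac (f (F \<union> G) - f F - f G)\<bar> < 1 / (2 * 3 ^ d)" if G: "G \<subseteq> A - F" for G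
    proof -
      let ?y = "cfrac (f (F \<union> G)) - cfrac (f F) - cfrac (f G)"
      have "F \<union> G \<subseteq> A" "G \<subseteq> A" using F G by auto
      note Suc.prems(2)[OF this(1)] Suc.prems(2)[OF F] Suc.prems(2)[OF this(2)]
      moreover have "1 / (2 * 3 ^ d) = 3 * (1 / (2 * 3 ^ Suc d) :: real)" by simp
      ultimately have y: "\<bar>?y\<bar> < 1 / (2 * 3 ^ d)" by linarith
      also have "(1::real) / (2 * 3 ^ d) \<le> 1 / 2" by (simp add: field_simps)
      finally have y2: "\<bar>?y\<bar> < 1 / 2" .
      have "(f (F \<union> G) - cfrac (f (F \<union> G))) - (f F - cfrac (f F)) - (f G - cfrac (f G)) \<in> \<int>"
        by (intro Ints_diff cfrac_diff_Ints)
      then have "f (F \<union> G) - f F - f G - ?y \<in> \<int>" by (simp add: algebra_simps)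
      from cfrac_eqI[OF y2 this] y
      show "cfrac (f (F \<union> G) - f F - f G) = ?y"
        and "\<bar>cfrac (f (F \<union> G) - f F - f G)\<bar> < 1 / (2 * 3 ^ d)" by simp_all
    qed
    have "set_poly d (A - F) (\<lambda>G. cfrac (f (F \<union> G) - f F - f G))"
      using Suc.IH[OF set_polyD[OF Suc.prems(1) F] small] .
    then show "set_poly d (A - F) (\<lambda>G. cfrac (f (F \<union> G)) - cfrac (f F) - cfrac (f G))"
      by (rule set_poly_cong) (use eq in auto)
  qed
qed auto

text \<open>The abstract form of n = d |F|. Passing to unions of blocks destroys the shape d |F| but
  keeps additivity, so this is the property that survives repeated reductions.\<close>

definition additive_on :: "nat set \<Rightarrow> (nat set \<Rightarrow> nat) \<Rightarrow> bool" where
  "additive_on A \<nu> \<longleftrightarrow> (\<forall>F\<subseteq>A. \<forall>G\<subseteq>A. F \<inter> G = {} \<longrightarrow> \<nu> (F \<union> G) = \<nu> F + \<nu> G)"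

lemma set_poly_additive: "additive_on A \<nu> \<Longrightarrow> set_poly (Suc 0) A (\<lambda>F. real (\<nu> F))"
  unfolding set_poly.simps
proof (intro allI impI)
  fix F G assume "additive_on A \<nu>" "F \<subseteq> A" "G \<subseteq> A - F"
  moreover from this have "G \<subseteq> A" "F \<inter> G = {}" by auto
  ultimately have "\<nu> (F \<union> G) = \<nu> F + \<nu> G" unfolding additive_on_def by blast
  then show "real (\<nu> (F \<union> G)) - real (\<nu> F) - real (\<nu> G) = 0" by simp
qed

lemma set_poly_power:
  assumes "set_poly (Suc 0) A f"
  shows "set_poly (Suc j) A (\<lambda>F. f F ^ Suc j)"
proof (induction j)
  case (Suc j)
  from set_poly_mult[OF assms Suc] show ?case by simp
qed (use assms in simp)

lemma set_poly_sum_list: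
  "(\<And>x. x \<in> set xs \<Longrightarrow> set_poly d A (f x)) \<Longrightarrow> set_poly d A (\<lambda>F. \<Sum>x\<leftarrow>xs. f x F)"
  by (induction xs) (auto intro: set_poly_add set_poly_zero)

section \<open>Block maps\<close>

text \<open>A block map is the union map \<open>F \<mapsto> \<Union>\<^bsub>j\<in>F\<^esub> B\<^sub>j\<close> for disjoint nonempty blocks \<open>B\<^sub>j\<close>, in a form that makes
  composition immediate.\<close>

definition block_map :: "nat set \<Rightarrow> nat set \<Rightarrow> (nat set \<Rightarrow> nat set) \<Rightarrow> bool" where
  "block_map A A' \<phi> \<longleftrightarrow> (\<forall>F\<subseteq>A. \<phi> F \<subseteq> A' \<and> (F \<noteq> {} \<longrightarrow> \<phi> F \<noteq> {})) \<and>
     (\<forall>F\<subseteq>A. \<forall>G\<subseteq>A. F \<inter> G = {} \<longrightarrow> \<phi> (F \<union> G) = \<phi> F \<union> \<phi> G \<and> \<phi> F \<inter> \<phi> G = {})"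

lemma block_mapD:
  assumes "block_map A A' \<phi>" "F \<subseteq> A"
  shows "\<phi> F \<subseteq> A'" "F \<noteq> {} \<Longrightarrow> \<phi> F \<noteq> {}"
    "\<And>G. G \<subseteq> A \<Longrightarrow> F \<inter> G = {} \<Longrightarrow> \<phi> (F \<union> G) = \<phi> F \<union> \<phi> G"
    "\<And>G. G \<subseteq> A \<Longrightarrow> F \<inter> G = {} \<Longrightarrow> \<phi> F \<inter> \<phi> G = {}"
proof -
  note * = assms(1)[unfolded block_map_def]
  note 1 = *[THEN conjunct1, rule_format, OF assms(2)]
  note 2 = *[THEN conjunct2, rule_format, OF assms(2)]
  show "\<phi> F \<subseteq> A'" "F \<noteq> {} \<Longrightarrow> \<phi> F \<noteq> {}" using 1 by simp_all
  show "\<phi> (F \<union> G) = \<phi> F \<union> \<phi> G" "\<phi> F \<inter> \<phi> G = {}" if "G \<subseteq> A" "F \<inter> G = {}" for G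
    using 2[OF that] by simp_all
qed

lemma block_map_id: "block_map A A (\<lambda>F. F)"
  by (auto simp: block_map_def)

lemma block_map_comp:
  assumes "block_map A A' \<phi>" "block_map A' A'' \<psi>"
  shows "block_map A A'' (\<lambda>F. \<psi> (\<phi> F))"
  unfolding block_map_def
proof (intro conjI allI impI)
  fix F assume F: "F \<subseteq> A"
  note \<phi>F = block_mapD[OF assms(1) F]
  note \<psi>F = block_mapD[OF assms(2) \<phi>F(1)]
  show "\<psi> (\<phi> F) \<subseteq> A''" by (rule \<psi>F(1))
  show "\<psi> (\<phi> F) \<noteq> {}" if "F \<noteq> {}" using that \<phi>F(2) \<psi>F(2) by blast
  fix G assume G: "G \<subseteq> A" "F \<inter> G = {}"
  note \<phi>G = block_mapD(1)[OF assms(1) G(1)]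
  show "\<psi> (\<phi> (F \<union> G)) = \<psi> (\<phi> F) \<union> \<psi> (\<phi> G)"
    using \<phi>F(3)[OF G] \<psi>F(3)[OF \<phi>G \<phi>F(4)[OF G]] by simp
  show "\<psi> (\<phi> F) \<inter> \<psi> (\<phi> G) = {}"
    by (rule \<psi>F(4)[OF \<phi>G \<phi>F(4)[OF G]])
qed

text \<open>Disjointness of blocks keeps the image of a set outside F away from
  \<open>\<phi> F\<close>. Differences of set functions live on complements, so the induction for
  \<open>set_poly_block_map\<close> needs the map in this form.\<close>

lemma block_map_Diff:
  assumes "block_map A A' \<phi>" "F \<subseteq> A"
  shows "block_map (A - F) (A' - \<phi> F) \<phi>"
  unfolding block_map_def
proof (intro conjI allI impI)
  fix G assume "G \<subseteq> A - F"
  then have G: "G \<subseteq> A" "F \<inter> G = {}" by auto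
  show "\<phi> G \<subseteq> A' - \<phi> F"
    using block_mapD(1)[OF assms(1) G(1)] block_mapD(4)[OF assms G] by blast
  show "\<phi> G \<noteq> {}" if "G \<noteq> {}" using block_mapD(2)[OF assms(1) G(1) that] .
  fix H assume "H \<subseteq> A - F" "G \<inter> H = {}"
  then have H: "H \<subseteq> A" "G \<inter> H = {}" by auto
  show "\<phi> (G \<union> H) = \<phi> G \<union> \<phi> H" "\<phi> G \<inter> \<phi> H = {}"
    using block_mapD(3,4)[OF assms(1) G(1) H] by auto
qed

lemma set_poly_block_map:
  "set_poly d A' f \<Longrightarrow> block_map A A' \<phi> \<Longrightarrow> set_poly d A (\<lambda>F. f (\<phi> F))"
proof (induction d arbitrary: A A' f)
  case 0
  then show ?case using block_mapD(1) by simp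
next
  case (Suc d)
  show ?case
    unfolding set_poly.simps
  proof (intro allI impI)
    fix F assume F: "F \<subseteq> A"
    have "\<phi> F \<subseteq> A'" using block_mapD(1)[OF Suc.prems(2) F] .
    then have "set_poly d (A' - \<phi> F) (\<lambda>G. f (\<phi> F \<union> G) - f (\<phi> F) - f G)"
      by (rule set_polyD[OF Suc.prems(1)])
    from Suc.IH[OF this block_map_Diff[OF Suc.prems(2) F]]
    show "set_poly d (A - F) (\<lambda>G. f (\<phi> (F \<union> G)) - f (\<phi> F) - f (\<phi> G))"
    proof (rule set_poly_cong)
      fix G assume "G \<subseteq> A - F"
      then have "G \<subseteq> A" "F \<inter> G = {}" by auto
      from block_mapD(3)[OF Suc.prems(2) F this]
      show "f (\<phi> F \<union> \<phi> G) - f (\<phi> F) - f (\<phi> G) = f (\<phi> (F \<union> G)) - f (\<phi> F) - f (\<phi> G)"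
        by simp
    qed
  qed
qed

lemma additive_on_block_map:
  assumes "additive_on A' \<nu>" "block_map A A' \<phi>"
  shows "additive_on A (\<lambda>F. \<nu> (\<phi> F))"
  unfolding additive_on_def
proof (intro allI impI)
  fix F G assume FG: "F \<subseteq> A" "G \<subseteq> A" "F \<inter> G = {}"
  then show "\<nu> (\<phi> (F \<union> G)) = \<nu> (\<phi> F) + \<nu> (\<phi> G)"
    using assms(1) block_mapD(1)[OF assms(2) FG(1)] block_mapD(1)[OF assms(2) FG(2)]
      block_mapD(3,4)[OF assms(2) FG] unfolding additive_on_def by auto
qed

lemma block_map_Union:
  assumes "\<And>j. j \<in> I \<Longrightarrow> B j \<subseteq> A \<and> B j \<noteq> {}"
    and "\<And>i j. i \<in> I \<Longrightarrow> j \<in> I \<Longrightarrow> i \<noteq> j \<Longrightarrow> B i \<inter> B j = {}"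
  shows "block_map I A (\<lambda>J. \<Union>(B ` J))"
  unfolding block_map_def
proof (intro conjI allI impI)
  fix F assume F: "F \<subseteq> I"
  show "\<Union>(B ` F) \<subseteq> A" using F assms(1) by blast
  show "\<Union>(B ` F) \<noteq> {}" if "F \<noteq> {}" using that F assms(1) by blast
  fix G assume G: "G \<subseteq> I" "F \<inter> G = {}"
  show "\<Union>(B ` (F \<union> G)) = \<Union>(B ` F) \<union> \<Union>(B ` G)" by auto
  have "B i \<inter> B j = {}" if "i \<in> F" "j \<in> G" for i j
    using that F G by (intro assms(2)) auto
  then show "\<Union>(B ` F) \<inter> \<Union>(B ` G) = {}" by blast
qed

section \<open>Recurrence\<close>

text \<open>The order of quantifiers is the point: \<open>K\<close> depends on the degree, the
  number of functions and \<epsilon>, but not on the functions. This makes the final constants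
  independent of the realisation. \<open>A\<close> is an arbitrary finite set because blocks are
  later sought in what earlier choices leave over.\<close>

definition recurrent_degree :: "nat \<Rightarrow> bool" where
  "recurrent_degree d \<longleftrightarrow> (\<forall>r. \<forall>\<epsilon>>0. \<exists>K. \<forall>A \<F>. finite A \<longrightarrow> K \<le> card A \<longrightarrow>
     finite \<F> \<longrightarrow> card \<F> \<le> r \<longrightarrow> (\<forall>f\<in>\<F>. set_poly d A f) \<longrightarrow>
     (\<exists>B\<subseteq>A. B \<noteq> {} \<and> (\<forall>f\<in>\<F>. \<bar>cfrac (f B)\<bar> < \<epsilon>)))"

lemma recurrent_degreeD:
  assumes "recurrent_degree d" "\<epsilon> > 0"
  obtains K where "\<And>A \<F>. finite A \<Longrightarrow> K \<le> card A \<Longrightarrow> finite \<F> \<Longrightarrow> card \<F> \<le> r \<Longrightarrow>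
    (\<And>f. f \<in> \<F> \<Longrightarrow> set_poly d A f) \<Longrightarrow> \<exists>B\<subseteq>A. B \<noteq> {} \<and> (\<forall>f\<in>\<F>. \<bar>cfrac (f B)\<bar> < \<epsilon>)"
proof (rule exE[OF assms(1)[unfolded recurrent_degree_def, rule_format, OF assms(2), of r]])
  fix K
  assume "\<forall>A \<F>. finite A \<longrightarrow> K \<le> card A \<longrightarrow> finite \<F> \<longrightarrow> card \<F> \<le> r \<longrightarrow>
    (\<forall>f\<in>\<F>. set_poly d A f) \<longrightarrow> (\<exists>B\<subseteq>A. B \<noteq> {} \<and> (\<forall>f\<in>\<F>. \<bar>cfrac (f B)\<bar> < \<epsilon>))"
  from that[OF this[rule_format]] show thesis .
qed

text \<open>The blocks are chosen one after the other; the \<open>j\<close>-th block takes care of the functions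
  attached to all unions of earlier blocks.\<close>

lemma recurrent_degree_blocks:
  fixes L :: nat
  assumes "recurrent_degree d" "\<epsilon> > 0"
  shows "\<exists>K. \<forall>A H. finite A \<longrightarrow> K \<le> card A \<longrightarrow>
    (\<forall>F\<subseteq>A. finite (H F) \<and> card (H F) \<le> r \<and> (\<forall>h\<in>H F. set_poly d (A - F) h)) \<longrightarrow>
    (\<exists>B. (\<forall>j<L. B j \<subseteq> A \<and> B j \<noteq> {}) \<and> (\<forall>i<L. \<forall>j<L. i \<noteq> j \<longrightarrow> B i \<inter> B j = {}) \<and>
       (\<forall>j<L. \<forall>J\<subseteq>{..<j}. \<forall>h\<in>H (\<Union>(B ` J)). \<bar>cfrac (h (B j))\<bar> < \<epsilon>))"
proof (induction L)
  case 0
  show ?case by auto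
next
  case (Suc L)
  then obtain K where K: "\<forall>A H. finite A \<longrightarrow> K \<le> card A \<longrightarrow>
    (\<forall>F\<subseteq>A. finite (H F) \<and> card (H F) \<le> r \<and> (\<forall>h\<in>H F. set_poly d (A - F) h)) \<longrightarrow>
    (\<exists>B. (\<forall>j<L. B j \<subseteq> A \<and> B j \<noteq> {}) \<and> (\<forall>i<L. \<forall>j<L. i \<noteq> j \<longrightarrow> B i \<inter> B j = {}) \<and>
       (\<forall>j<L. \<forall>J\<subseteq>{..<j}. \<forall>h\<in>H (\<Union>(B ` J)). \<bar>cfrac (h (B j))\<bar> < \<epsilon>))" ..
  \<comment> \<open>The first L blocks will lie in a set of K elements. It has 2^K subsets, each
    carrying at most r functions, and the last block must serve all of them at once.\<close>
  obtain K' where K': "\<And>A \<F>. finite A \<Longrightarrow> K' \<le> card A \<Longrightarrow> finite \<F> \<Longrightarrow> card \<F> \<le> 2 ^ K * r \<Longrightarrow>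
    (\<And>f. f \<in> \<F> \<Longrightarrow> set_poly d A f) \<Longrightarrow> \<exists>B\<subseteq>A. B \<noteq> {} \<and> (\<forall>f\<in>\<F>. \<bar>cfrac (f B)\<bar> < \<epsilon>)"
    by (fact recurrent_degreeD[OF assms, of "2 ^ K * r"])
  show ?case
  proof (intro exI[of _ "K + K'"] allI impI)
    fix A :: "nat set" and H
    assume A: "finite A" "K + K' \<le> card A"
      and H: "\<forall>F\<subseteq>A. finite (H F) \<and> card (H F) \<le> r \<and> (\<forall>h\<in>H F. set_poly d (A - F) h)"
    \<comment> \<open>\<open>A0\<close> is reserved for the first L blocks. The last one is taken
      from the remaining points, of which there are at least \<open>K'\<close>, so it is disjoint
      from the others.\<close>
    obtain A0 where A0: "A0 \<subseteq> A" "card A0 = K" "finite A0"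
      using A obtain_subset_with_card_n[of K A] by (metis add_leD1)
    have "\<exists>B. (\<forall>j<L. B j \<subseteq> A0 \<and> B j \<noteq> {}) \<and> (\<forall>i<L. \<forall>j<L. i \<noteq> j \<longrightarrow> B i \<inter> B j = {}) \<and>
       (\<forall>j<L. \<forall>J\<subseteq>{..<j}. \<forall>h\<in>H (\<Union>(B ` J)). \<bar>cfrac (h (B j))\<bar> < \<epsilon>)"
    proof (rule K[rule_format])
      fix F assume F: "F \<subseteq> A0"
      then have "F \<subseteq> A" and sub: "A0 - F \<subseteq> A - F" using A0 by auto
      from H[rule_format, OF this(1)] set_poly_subset[OF _ sub]
      show "finite (H F) \<and> card (H F) \<le> r \<and> (\<forall>h\<in>H F. set_poly d (A0 - F) h)"
        by simp
    qed (use A0 in auto)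
    then obtain B where B_block: "\<forall>j<L. B j \<subseteq> A0 \<and> B j \<noteq> {}"
      and B_disjoint: "\<forall>i<L. \<forall>j<L. i \<noteq> j \<longrightarrow> B i \<inter> B j = {}"
      and B_small: "\<forall>j<L. \<forall>J\<subseteq>{..<j}. \<forall>h\<in>H (\<Union>(B ` J)). \<bar>cfrac (h (B j))\<bar> < \<epsilon>"
      by (elim exE conjE)
    have "\<exists>C\<subseteq>A - A0. C \<noteq> {} \<and> (\<forall>h\<in>\<Union>(H ` Pow A0). \<bar>cfrac (h C)\<bar> < \<epsilon>)"
    proof (rule K')
      show "finite (A - A0)" using A by simp
      show "K' \<le> card (A - A0)" using A A0 by (simp add: card_Diff_subset)
      have H': "finite (H F)" "card (H F) \<le> r" if "F \<in> Pow A0" for F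
        using that H A0 by blast+
      show "finite (\<Union>(H ` Pow A0))" using A0 H' by blast
      have "card (\<Union>(H ` Pow A0)) \<le> (\<Sum>F\<in>Pow A0. card (H F))"
        using A0 by (intro card_UN_le) auto
      also have "\<dots> \<le> card (Pow A0) * r"
        using sum_bounded_above[of "Pow A0" "\<lambda>F. card (H F)" r] H' by simp
      finally show "card (\<Union>(H ` Pow A0)) \<le> 2 ^ K * r" using A0 by (simp add: card_Pow)
      fix h assume "h \<in> \<Union>(H ` Pow A0)"
      then obtain F where F: "F \<subseteq> A0" "h \<in> H F" by auto
      then have "set_poly d (A - F) h" using H A0 by blast
      then show "set_poly d (A - A0) h" using F by (elim set_poly_subset) auto
    qed
    then obtain C where C: "C \<subseteq> A - A0" "C \<noteq> {}"
      "\<forall>h\<in>\<Union>(H ` Pow A0). \<bar>cfrac (h C)\<bar> < \<epsilon>" by (elim exE conjE)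
    have CB: "C \<inter> B j = {}" if "j < L" for j using C(1) B_block that by blast
    have im: "(B(L := C)) ` J = B ` J" if "J \<subseteq> {..<L}" for J
      using that by (intro image_cong) auto
    show "\<exists>B. (\<forall>j<Suc L. B j \<subseteq> A \<and> B j \<noteq> {}) \<and> (\<forall>i<Suc L. \<forall>j<Suc L. i \<noteq> j \<longrightarrow> B i \<inter> B j = {}) \<and>
       (\<forall>j<Suc L. \<forall>J\<subseteq>{..<j}. \<forall>h\<in>H (\<Union>(B ` J)). \<bar>cfrac (h (B j))\<bar> < \<epsilon>)"
    proof (intro exI[of _ "B(L := C)"] conjI allI impI ballI)
      fix j assume j: "j < Suc L"
      show "(B(L := C)) j \<subseteq> A" "(B(L := C)) j \<noteq> {}"
        using j B_block C(1,2) A0(1) by (cases "j = L"; auto simp: less_Suc_eq)+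
      show "(B(L := C)) j \<inter> (B(L := C)) i = {}" if "i < Suc L" "j \<noteq> i" for i
        using that j B_disjoint[rule_format, of j i] CB[of i] CB[of j] by (auto simp: less_Suc_eq)
      fix J h assume J: "J \<subseteq> {..<j}" "h \<in> H (\<Union>((B(L := C)) ` J))"
      have "J \<subseteq> {..<L}" using J j by auto
      with J(2) have h: "h \<in> H (\<Union>(B ` J))" by (simp only: im)
      show "\<bar>cfrac (h ((B(L := C)) j))\<bar> < \<epsilon>"
      proof (cases "j = L")
        case True
        then have "\<Union>(B ` J) \<subseteq> A0" using J B_block by fastforce
        then show ?thesis using C(3) h True by auto
      next
        case False
        then have "j < L" using j by simp
          with B_small J(1) h False show ?thesis by simp
      qed
    qed
  qed
qed

lemma recurrent_degree_blocksD:
  assumes "recurrent_degree d" "\<epsilon> > 0"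
  obtains K where "\<And>A H. finite A \<Longrightarrow> K \<le> card A \<Longrightarrow>
    (\<And>F. F \<subseteq> A \<Longrightarrow> finite (H F) \<and> card (H F) \<le> r \<and> (\<forall>h\<in>H F. set_poly d (A - F) h)) \<Longrightarrow>
    \<exists>B. block_map {..<L} A (\<lambda>J. \<Union>(B ` J)) \<and>
       (\<forall>j<L. \<forall>J\<subseteq>{..<j}. \<forall>h\<in>H (\<Union>(B ` J)). \<bar>cfrac (h (B j))\<bar> < \<epsilon>)"
proof -
  from recurrent_degree_blocks[OF assms, of r L] obtain K where K: "\<forall>A H. finite A \<longrightarrow> K \<le> card A \<longrightarrow>
    (\<forall>F\<subseteq>A. finite (H F) \<and> card (H F) \<le> r \<and> (\<forall>h\<in>H F. set_poly d (A - F) h)) \<longrightarrow>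
    (\<exists>B. (\<forall>j<L. B j \<subseteq> A \<and> B j \<noteq> {}) \<and> (\<forall>i<L. \<forall>j<L. i \<noteq> j \<longrightarrow> B i \<inter> B j = {}) \<and>
       (\<forall>j<L. \<forall>J\<subseteq>{..<j}. \<forall>h\<in>H (\<Union>(B ` J)). \<bar>cfrac (h (B j))\<bar> < \<epsilon>))" ..
  show thesis
  proof (rule that[of K])
    fix A H
    assume "finite A" "K \<le> card A"
      "\<And>F. F \<subseteq> A \<Longrightarrow> finite (H F) \<and> card (H F) \<le> r \<and> (\<forall>h\<in>H F. set_poly d (A - F) h)"
    then have "\<exists>B. (\<forall>j<L. B j \<subseteq> A \<and> B j \<noteq> {}) \<and> (\<forall>i<L. \<forall>j<L. i \<noteq> j \<longrightarrow> B i \<inter> B j = {}) \<and>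
       (\<forall>j<L. \<forall>J\<subseteq>{..<j}. \<forall>h\<in>H (\<Union>(B ` J)). \<bar>cfrac (h (B j))\<bar> < \<epsilon>)"
      by (rule K[rule_format])
    then obtain B where B: "\<forall>j<L. B j \<subseteq> A \<and> B j \<noteq> {}"
      "\<forall>i<L. \<forall>j<L. i \<noteq> j \<longrightarrow> B i \<inter> B j = {}"
      "\<forall>j<L. \<forall>J\<subseteq>{..<j}. \<forall>h\<in>H (\<Union>(B ` J)). \<bar>cfrac (h (B j))\<bar> < \<epsilon>" by blast
    have "block_map {..<L} A (\<lambda>J. \<Union>(B ` J))"
      using B(1,2) by (intro block_map_Union) auto
    then show "\<exists>B. block_map {..<L} A (\<lambda>J. \<Union>(B ` J)) \<and>
       (\<forall>j<L. \<forall>J\<subseteq>{..<j}. \<forall>h\<in>H (\<Union>(B ` J)). \<bar>cfrac (h (B j))\<bar> < \<epsilon>)"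
      using B(3) by blast
  qed
qed

text \<open>The fractional parts of the values at one index form a point of a unit cube of dimension
  at most r, cut into at most q^r cells of side 1/q. The q^r + 1 indices from 0 to q^r cannot all
  lie in different cells.\<close>

lemma simultaneous_pigeonhole:
  fixes s :: "'a \<Rightarrow> nat \<Rightarrow> real"
  assumes "finite \<F>" "card \<F> \<le> r" "q > 0"
  shows "\<exists>a b. a < b \<and> b \<le> q ^ r \<and> (\<forall>f\<in>\<F>. \<bar>cfrac (s f b - s f a)\<bar> < 1 / real q)"
proof -
  \<comment> \<open>The lambda restricted to \<open>\<F>\<close> makes cells elements of a finite
    extensional function space, which can be counted.\<close>
  define cell where "cell j = (\<lambda>f\<in>\<F>. nat \<lfloor>real q * frac (s f j)\<rfloor>)" for j
  have cell: "cell j \<in> \<F> \<rightarrow>\<^sub>E {..<q}" for j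
  proof -
    have "nat \<lfloor>real q * frac x\<rfloor> < q" for x :: real
    proof -
      have "real q * frac x < real q" using frac_lt_1[of x] assms(3) by simp
      moreover have "0 \<le> real q * frac x" by simp
      ultimately show ?thesis by linarith
    qed
    then show ?thesis by (simp add: cell_def)
  qed
  have "card (\<F> \<rightarrow>\<^sub>E {..<q}) = q ^ card \<F>"
    using assms(1) by (simp add: card_PiE)
  also have "\<dots> \<le> q ^ r" using assms by (intro power_increasing) auto
  also have "\<dots> < card {..q ^ r}" by simp
  finally have "card (\<F> \<rightarrow>\<^sub>E {..<q}) < card {..q ^ r}" .
  moreover have "finite (\<F> \<rightarrow>\<^sub>E {..<q})" using assms(1) by (intro finite_PiE) auto
  then have "card (cell ` {..q ^ r}) \<le> card (\<F> \<rightarrow>\<^sub>E {..<q})"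
    using cell by (intro card_mono) auto
  ultimately have "\<not> inj_on cell {..q ^ r}" by (intro pigeonhole) linarith
  then obtain a b where ab: "a < b" "b \<le> q ^ r" "cell a = cell b"
    unfolding inj_on_def by (metis atMost_iff linorder_neqE_nat)
  have "\<bar>cfrac (s f b - s f a)\<bar> < 1 / real q" if f: "f \<in> \<F>" for f
  proof -
    have "nat \<lfloor>real q * frac (s f a)\<rfloor> = nat \<lfloor>real q * frac (s f b)\<rfloor>"
      using fun_cong[OF ab(3), of f] f by (simp add: cell_def)
    moreover have "0 \<le> real q * frac (s f a)" "0 \<le> real q * frac (s f b)" by simp_all
    ultimately have "\<lfloor>real q * frac (s f a)\<rfloor> = \<lfloor>real q * frac (s f b)\<rfloor>"
      by (simp add: nat_eq_iff2)
    then have "\<bar>real q * frac (s f b) - real q * frac (s f a)\<bar> < 1" by linarith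
    then have "real q * \<bar>frac (s f b) - frac (s f a)\<bar> < 1"
      by (simp add: abs_mult flip: right_diff_distrib)
    then have "\<bar>frac (s f b) - frac (s f a)\<bar> < 1 / real q"
      using assms(3) by (simp add: field_simps)
    moreover have "s f b - s f a - (frac (s f b) - frac (s f a)) \<in> \<int>"
      by (simp add: frac_def)
    ultimately show ?thesis using abs_cfrac_le by (metis order_le_less_trans)
  qed
  then show ?thesis using ab by blast
qed

text \<open>The differences have degree \<open>d\<close>, so blocks can be chosen that make them
  small along all unions of earlier blocks. On a run of consecutive blocks each \<open>f\<close> is
  then nearly the sum of its values at the single blocks. Two partial sums nearly equal modulo 1 for
  all \<open>f\<close> enclose the run that is wanted.\<close>

lemma recurrent_degree_Suc:
  assumes "recurrent_degree d"
  shows "recurrent_degree (Suc d)"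
  unfolding recurrent_degree_def
proof (intro allI impI)
  fix r and \<epsilon> :: real assume \<epsilon>: "\<epsilon> > 0"
  obtain q :: nat where q: "q > 0" "1 / real q < \<epsilon> / 2"
  proof -
    obtain n where "inverse (real (Suc n)) < \<epsilon> / 2"
      using reals_Archimedean[of "\<epsilon> / 2"] \<epsilon> by auto
    then show thesis using that[of "Suc n"] by (simp add: inverse_eq_divide)
  qed
  \<comment> \<open>With q^r blocks there are q^r + 1 partial sums, counting the empty one, as the
    pigeonhole argument requires.\<close>
  define L where "L = q ^ r"
  have L: "L > 0" using q by (simp add: L_def)
  \<comment> \<open>At most L errors of this size accumulate, which costs \<epsilon>/2; the other
    half is spent on the pigeonhole error 1/q.\<close>
  define \<eta> where "\<eta> = \<epsilon> / (2 * real L)"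
  have \<eta>: "\<eta> > 0" using \<epsilon> L by (simp add: \<eta>_def)
  obtain K where K: "\<And>A H. finite A \<Longrightarrow> K \<le> card A \<Longrightarrow>
    (\<And>F. F \<subseteq> A \<Longrightarrow> finite (H F) \<and> card (H F) \<le> r \<and> (\<forall>h\<in>H F. set_poly d (A - F) h)) \<Longrightarrow>
    \<exists>B. block_map {..<L} A (\<lambda>J. \<Union>(B ` J)) \<and>
       (\<forall>j<L. \<forall>J\<subseteq>{..<j}. \<forall>h\<in>H (\<Union>(B ` J)). \<bar>cfrac (h (B j))\<bar> < \<eta>)"
    by (fact recurrent_degree_blocksD[OF assms \<eta>, of r L])
  show "\<exists>K. \<forall>A \<F>. finite A \<longrightarrow> K \<le> card A \<longrightarrow> finite \<F> \<longrightarrow> card \<F> \<le> r \<longrightarrow>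
     (\<forall>f\<in>\<F>. set_poly (Suc d) A f) \<longrightarrow> (\<exists>B\<subseteq>A. B \<noteq> {} \<and> (\<forall>f\<in>\<F>. \<bar>cfrac (f B)\<bar> < \<epsilon>))"
  proof (intro exI[of _ K] allI impI)
    fix A :: "nat set" and \<F>
    assume A: "finite A" "K \<le> card A" and F: "finite \<F>" "card \<F> \<le> r"
      and poly: "\<forall>f\<in>\<F>. set_poly (Suc d) A f"
    define H where "H F = (\<lambda>f G. f (F \<union> G) - f F - f G) ` \<F>" for F
    have "\<exists>B. block_map {..<L} A (\<lambda>J. \<Union>(B ` J)) \<and>
       (\<forall>j<L. \<forall>J\<subseteq>{..<j}. \<forall>h\<in>H (\<Union>(B ` J)). \<bar>cfrac (h (B j))\<bar> < \<eta>)"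
    proof (rule K[OF A])
      fix F assume "F \<subseteq> A"
      then show "finite (H F) \<and> card (H F) \<le> r \<and> (\<forall>h\<in>H F. set_poly d (A - F) h)"
        unfolding H_def using F poly order_trans[OF card_image_le[OF F(1)] F(2)]
        by (auto intro: set_polyD[of d A])
    qed
    then obtain B where B: "block_map {..<L} A (\<lambda>J. \<Union>(B ` J))"
      "\<forall>j<L. \<forall>J\<subseteq>{..<j}. \<forall>h\<in>H (\<Union>(B ` J)). \<bar>cfrac (h (B j))\<bar> < \<eta>" by (elim exE conjE)
    \<comment> \<open>Adjoining block b to the union of the preceding ones adds one value of a
      function in \<open>H\<close>, taken at that union, hence an error below \<eta>.\<close>
    have almost_additive: "\<bar>cfrac (f (\<Union>(B ` {a..<b})) - (\<Sum>j\<in>{a..<b}. f (B j)))\<bar> \<le> real (b - a) * \<eta>"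
      if f: "f \<in> \<F>" and "a \<le> b" "b \<le> L" for f a b
      using that(2,3)
    proof (induction b rule: dec_induct)
      case base
      then show ?case using set_poly_empty[of "Suc d" A f] poly f by simp
    next
      case (step b)
      let ?U = "\<Union>(B ` {a..<b})"
      have "{a..<Suc b} = insert b {a..<b}" using step by auto
      then have eq: "f (\<Union>(B ` {a..<Suc b})) - (\<Sum>j\<in>{a..<Suc b}. f (B j)) =
          (f ?U - (\<Sum>j\<in>{a..<b}. f (B j))) + (f (?U \<union> B b) - f ?U - f (B b))"
        by (simp add: Un_commute)
      have "(\<lambda>G. f (?U \<union> G) - f ?U - f G) \<in> H ?U" using f by (auto simp: H_def)
      then have "\<bar>cfrac (f (?U \<union> B b) - f ?U - f (B b))\<bar> < \<eta>"
        using B(2)[rule_format, of b "{a..<b}" "\<lambda>G. f (?U \<union> G) - f ?U - f G"] step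
        by (simp add: ivl_subset lessThan_atLeast0)
      moreover have "\<bar>cfrac (f ?U - (\<Sum>j\<in>{a..<b}. f (B j)))\<bar> \<le> real (b - a) * \<eta>"
        using step by simp
      moreover have "real (Suc b - a) * \<eta> = real (b - a) * \<eta> + \<eta>"
        using step by (simp add: Suc_diff_le algebra_simps)
      ultimately show ?case
        unfolding eq using abs_cfrac_add_le[of "f ?U - (\<Sum>j\<in>{a..<b}. f (B j))" "f (?U \<union> B b) - f ?U - f (B b)"]
        by linarith
    qed
    obtain a b where ab: "a < b" "b \<le> L"
      and s: "\<And>f. f \<in> \<F> \<Longrightarrow> \<bar>cfrac ((\<Sum>j<b. f (B j)) - (\<Sum>j<a. f (B j)))\<bar> < 1 / real q"
      using simultaneous_pigeonhole[OF F q(1), of "\<lambda>f n. \<Sum>j<n. f (B j)"] unfolding L_def by blast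
    have sub: "{a..<b} \<subseteq> {..<L}" using ab by auto
    show "\<exists>B\<subseteq>A. B \<noteq> {} \<and> (\<forall>f\<in>\<F>. \<bar>cfrac (f B)\<bar> < \<epsilon>)"
    proof (intro exI[of _ "\<Union>(B ` {a..<b})"] conjI ballI)
      show "\<Union>(B ` {a..<b}) \<subseteq> A" using block_mapD(1)[OF B(1) sub] .
      show "\<Union>(B ` {a..<b}) \<noteq> {}" using block_mapD(2)[OF B(1) sub] ab by simp
      fix f assume f: "f \<in> \<F>"
      \<comment> \<open>The difference of the two partial sums is the sum over the blocks a, ..., b
        - 1, a nonempty run since a < b.\<close>
      have "(\<Sum>j<b. f (B j)) - (\<Sum>j<a. f (B j)) = (\<Sum>j\<in>{a..<b}. f (B j))"
        using ab sum_diff_nat_ivl[of 0 a b "\<lambda>j. f (B j)"] by (simp add: lessThan_atLeast0)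
      then have 1: "\<bar>cfrac (\<Sum>j\<in>{a..<b}. f (B j))\<bar> < \<epsilon> / 2" using s[OF f] q by simp
      have "real (b - a) * \<eta> \<le> real L * \<eta>" using ab \<eta> by (intro mult_right_mono) auto
      also have "\<dots> = \<epsilon> / 2" using L by (simp add: \<eta>_def)
      finally have 2: "\<bar>cfrac (f (\<Union>(B ` {a..<b})) - (\<Sum>j\<in>{a..<b}. f (B j)))\<bar> \<le> \<epsilon> / 2"
        using almost_additive[OF f, of a b] ab by simp
      show "\<bar>cfrac (f (\<Union>(B ` {a..<b})))\<bar> < \<epsilon>"
        using abs_cfrac_add_le[of "f (\<Union>(B ` {a..<b})) - (\<Sum>j\<in>{a..<b}. f (B j))" "\<Sum>j\<in>{a..<b}. f (B j)"] 1 2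
        by simp
    qed
  qed
qed

lemma recurrent_degree: "recurrent_degree d"
proof (induction d)
  case 0
  show ?case
    unfolding recurrent_degree_def
  proof (intro allI impI exI[of _ 1])
    fix r and \<epsilon> :: real and A :: "nat set" and \<F> :: "(nat set \<Rightarrow> real) set"
    assume "\<epsilon> > 0" "finite A" "1 \<le> card A" "\<forall>f\<in>\<F>. set_poly 0 A f"
    moreover from this have "A \<noteq> {}" by auto
    ultimately show "\<exists>B\<subseteq>A. B \<noteq> {} \<and> (\<forall>f\<in>\<F>. \<bar>cfrac (f B)\<bar> < \<epsilon>)"
      by (intro exI[of _ A]) auto
  qed
qed (rule recurrent_degree_Suc)

text \<open>Strengthens recurrence from one set to all unions of blocks. Each new block makes the
  increment of \<open>f\<close> over every union of earlier blocks small, and adjoining the blocks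
  of \<open>J\<close> in increasing order telescopes. The increments have the same degree as
  \<open>f\<close>, so recurrence in degree \<open>d\<close> itself is used.\<close>

lemma block_map_cfrac_small:
  assumes "\<epsilon> > 0"
  obtains K where "\<And>f. set_poly d {..<K} f \<Longrightarrow>
    \<exists>\<phi>. block_map {..<k} {..<K} \<phi> \<and> (\<forall>J\<subseteq>{..<k}. \<bar>cfrac (f (\<phi> J))\<bar> < \<epsilon>)"
proof -
  \<comment> \<open>At most k increments add up; dividing by k + 1 gives a strict bound and avoids
    division by zero at k = 0.\<close>
  define \<eta> where "\<eta> = \<epsilon> / real (Suc k)"
  have \<eta>: "\<eta> > 0" using assms by (simp add: \<eta>_def)
  obtain K where K: "\<And>A H. finite A \<Longrightarrow> K \<le> card A \<Longrightarrow>
    (\<And>F. F \<subseteq> A \<Longrightarrow> finite (H F) \<and> card (H F) \<le> 1 \<and> (\<forall>h\<in>H F. set_poly d (A - F) h)) \<Longrightarrow>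
    \<exists>B. block_map {..<k} A (\<lambda>J. \<Union>(B ` J)) \<and>
       (\<forall>j<k. \<forall>J\<subseteq>{..<j}. \<forall>h\<in>H (\<Union>(B ` J)). \<bar>cfrac (h (B j))\<bar> < \<eta>)"
    by (fact recurrent_degree_blocksD[OF recurrent_degree[of d] \<eta>, of 1 k])
  show thesis
  proof (rule that[of K])
    fix f assume f: "set_poly d {..<K} f"
    define H where "H F = {\<lambda>G. f (F \<union> G) - f F}" for F
    have "\<exists>B. block_map {..<k} {..<K} (\<lambda>J. \<Union>(B ` J)) \<and>
       (\<forall>j<k. \<forall>J\<subseteq>{..<j}. \<forall>h\<in>H (\<Union>(B ` J)). \<bar>cfrac (h (B j))\<bar> < \<eta>)"
      using set_poly_shift[OF f] by (intro K) (auto simp: H_def)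
    then obtain B where B: "block_map {..<k} {..<K} (\<lambda>J. \<Union>(B ` J))"
      "\<forall>j<k. \<forall>J\<subseteq>{..<j}. \<forall>h\<in>H (\<Union>(B ` J)). \<bar>cfrac (h (B j))\<bar> < \<eta>"
      by (elim exE conjE)
    have bound: "\<bar>cfrac (f (\<Union>(B ` J)))\<bar> \<le> real (card J) * \<eta>" if "finite J" "J \<subseteq> {..<k}" for J
      using that
    proof (induction J rule: finite_linorder_max_induct)
      case empty
      then show ?case using set_poly_empty[OF f] by simp
    next
      case (insert j J)
      let ?U = "\<Union>(B ` J)"
      have "j < k" "J \<subseteq> {..<j}" using insert by auto
      then have "\<bar>cfrac (f (?U \<union> B j) - f ?U)\<bar> < \<eta>" using B(2) by (simp add: H_def)
      moreover have "\<bar>cfrac (f ?U)\<bar> \<le> real (card J) * \<eta>" using insert by simp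
      moreover have "card (insert j J) = Suc (card J)" using insert by auto
      moreover have "\<Union>(B ` insert j J) = ?U \<union> B j" by auto
      ultimately show ?case
        using abs_cfrac_add_le[of "f ?U" "f (?U \<union> B j) - f ?U"] by (simp add: algebra_simps)
    qed
    have "\<bar>cfrac (f (\<Union>(B ` J)))\<bar> < \<epsilon>" if J: "J \<subseteq> {..<k}" for J
    proof -
      have "card J \<le> k" using card_mono[OF _ J] by simp
      then have "real (card J) * \<eta> < real (Suc k) * \<eta>" using \<eta> by (intro mult_strict_right_mono) auto
      also have "\<dots> = \<epsilon>" by (simp add: \<eta>_def)
      finally show ?thesis using bound[OF finite_subset[OF J] J] by simp
    qed
    then show "\<exists>\<phi>. block_map {..<k} {..<K} \<phi> \<and> (\<forall>J\<subseteq>{..<k}. \<bar>cfrac (f (\<phi> J))\<bar> < \<epsilon>)"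
      using B(1) by blast
  qed
qed

section \<open>Bracket forms as polynomial set functions\<close>

text \<open>\<open>D\<close> is fixed before the number \<open>k\<close> of surviving blocks, and
  \<open>K\<close> before \<open>\<nu>\<close> and \<open>\<alpha>\<close>. Because \<open>k\<close>
  is arbitrary, enough blocks can be left over for any further reduction; because
  \<open>\<nu>\<close> is any additive function, that reduction can start from the blocks already
  formed.\<close>

definition poly_reducible :: "nat \<Rightarrow> bracket_form \<Rightarrow> bool" where
  "poly_reducible D \<Phi> \<longleftrightarrow> (\<forall>k. \<exists>K. \<forall>\<nu> \<alpha>. additive_on {..<K} \<nu> \<longrightarrow>
     (\<exists>\<phi>. block_map {..<k} {..<K} \<phi> \<and> set_poly D {..<k} (\<lambda>F. realise \<alpha> \<Phi> (\<nu> (\<phi> F)))))"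

lemma poly_reducibleD:
  assumes "poly_reducible D \<Phi>"
  obtains K where "\<And>\<nu> \<alpha>. additive_on {..<K} \<nu> \<Longrightarrow>
    \<exists>\<phi>. block_map {..<k} {..<K} \<phi> \<and> set_poly D {..<k} (\<lambda>F. realise \<alpha> \<Phi> (\<nu> (\<phi> F)))"
proof (rule exE[OF assms[unfolded poly_reducible_def, rule_format, of k]])
  fix K
  assume "\<forall>\<nu> \<alpha>. additive_on {..<K} \<nu> \<longrightarrow>
    (\<exists>\<phi>. block_map {..<k} {..<K} \<phi> \<and> set_poly D {..<k} (\<lambda>F. realise \<alpha> \<Phi> (\<nu> (\<phi> F))))"
  from that[OF this[rule_format]] show thesis .
qed

text \<open>The first form is reduced so as to leave as many blocks as the second requires. Merging
  these for the second form does not spoil the first, since block maps preserve the degree.\<close>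

lemma poly_reducible_pair:
  assumes "poly_reducible D\<^sub>1 \<Phi>\<^sub>1" "poly_reducible D\<^sub>2 \<Phi>\<^sub>2"
  obtains K where "\<And>\<nu> \<alpha>. additive_on {..<K} \<nu> \<Longrightarrow>
    \<exists>\<phi>. block_map {..<k} {..<K} \<phi> \<and> set_poly D\<^sub>1 {..<k} (\<lambda>F. realise \<alpha> \<Phi>\<^sub>1 (\<nu> (\<phi> F))) \<and>
      set_poly D\<^sub>2 {..<k} (\<lambda>F. realise \<alpha> \<Phi>\<^sub>2 (\<nu> (\<phi> F)))"
proof -
  obtain K\<^sub>2 where K2: "\<And>\<nu> \<alpha>. additive_on {..<K\<^sub>2} \<nu> \<Longrightarrow>
    \<exists>\<phi>. block_map {..<k} {..<K\<^sub>2} \<phi> \<and> set_poly D\<^sub>2 {..<k} (\<lambda>F. realise \<alpha> \<Phi>\<^sub>2 (\<nu> (\<phi> F)))"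
    by (fact poly_reducibleD[OF assms(2), of k])
  obtain K\<^sub>1 where K1: "\<And>\<nu> \<alpha>. additive_on {..<K\<^sub>1} \<nu> \<Longrightarrow>
    \<exists>\<phi>. block_map {..<K\<^sub>2} {..<K\<^sub>1} \<phi> \<and> set_poly D\<^sub>1 {..<K\<^sub>2} (\<lambda>F. realise \<alpha> \<Phi>\<^sub>1 (\<nu> (\<phi> F)))"
    by (fact poly_reducibleD[OF assms(1), of K\<^sub>2])
  show thesis
  proof (rule that[of K\<^sub>1])
    fix \<nu> \<alpha> assume \<nu>: "additive_on {..<K\<^sub>1} \<nu>"
    from K1[OF \<nu>] obtain \<phi>\<^sub>1 where 1: "block_map {..<K\<^sub>2} {..<K\<^sub>1} \<phi>\<^sub>1"
      "set_poly D\<^sub>1 {..<K\<^sub>2} (\<lambda>F. realise \<alpha> \<Phi>\<^sub>1 (\<nu> (\<phi>\<^sub>1 F)))" by blast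
    from K2[OF additive_on_block_map[OF \<nu> 1(1)]] obtain \<phi>\<^sub>2 where
      2: "block_map {..<k} {..<K\<^sub>2} \<phi>\<^sub>2"
      "set_poly D\<^sub>2 {..<k} (\<lambda>F. realise \<alpha> \<Phi>\<^sub>2 (\<nu> (\<phi>\<^sub>1 (\<phi>\<^sub>2 F))))" by blast
    show "\<exists>\<phi>. block_map {..<k} {..<K\<^sub>1} \<phi> \<and> set_poly D\<^sub>1 {..<k} (\<lambda>F. realise \<alpha> \<Phi>\<^sub>1 (\<nu> (\<phi> F))) \<and>
      set_poly D\<^sub>2 {..<k} (\<lambda>F. realise \<alpha> \<Phi>\<^sub>2 (\<nu> (\<phi> F)))"
      using block_map_comp[OF 2(1) 1(1)] set_poly_block_map[OF 1(2) 2(1)] 2(2)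
      by (intro exI[of _ "\<lambda>F. \<phi>\<^sub>1 (\<phi>\<^sub>2 F)"] conjI)
  qed
qed

text \<open>A positive power of an additive function is already a polynomial set function, so no
  merging of blocks is needed. The sum of the degrees is a crude common bound for the
  monomials.\<close>

lemma poly_reducible_BPoly:
  assumes "constant_free (BPoly p)"
  shows "poly_reducible (sum_list (map mono_degree p)) (BPoly p)"
  unfolding poly_reducible_def
proof (intro allI)
  fix k
  show "\<exists>K. \<forall>\<nu> \<alpha>. additive_on {..<K} \<nu> \<longrightarrow> (\<exists>\<phi>. block_map {..<k} {..<K} \<phi> \<and>
    set_poly (sum_list (map mono_degree p)) {..<k} (\<lambda>F. realise \<alpha> (BPoly p) (\<nu> (\<phi> F))))"
  proof (intro exI[of _ k] allI impI exI[of _ "\<lambda>F. F"] conjI block_map_id)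
    fix \<nu> \<alpha> assume \<nu>: "additive_on {..<k} \<nu>"
    have "set_poly (sum_list (map mono_degree p)) {..<k} (\<lambda>F. realise_monomial \<alpha> m (\<nu> F))"
      if m: "m \<in> set p" for m
    proof -
      \<comment> \<open>Constant-freeness enters here: a monomial of degree 0 need not vanish at the
        empty set.\<close>
      obtain j where j: "mono_degree m = Suc j"
        using assms m by (auto simp: Suc_le_eq gr0_conv_Suc)
      have "Suc j \<le> sum_list (map mono_degree p)"
        using member_le_sum_list[of "mono_degree m" "map mono_degree p"] m by (simp flip: j)
      from set_poly_mono[OF set_poly_cmult[OF set_poly_power[OF set_poly_additive[OF \<nu>]]] this]
      show ?thesis unfolding realise_monomial_def j .
    qed
    then show "set_poly (sum_list (map mono_degree p)) {..<k} (\<lambda>F. realise \<alpha> (BPoly p) (\<nu> F))"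
      unfolding realise.simps by (rule set_poly_sum_list)
  qed
qed

text \<open>Reduce the inner form first, then merge the blocks until its values on all unions are
  close enough to integers for \<open>set_poly_cfrac\<close>. The degree stays the same.\<close>

lemma poly_reducible_BFrac:
  assumes "poly_reducible D \<Phi>"
  shows "poly_reducible D (BFrac \<Phi>)"
  unfolding poly_reducible_def
proof (intro allI)
  fix k
  have pos: "(0::real) < 1 / (2 * 3 ^ D)" by simp
  obtain K' where K': "\<And>f. set_poly D {..<K'} f \<Longrightarrow>
    \<exists>\<phi>. block_map {..<k} {..<K'} \<phi> \<and> (\<forall>J\<subseteq>{..<k}. \<bar>cfrac (f (\<phi> J))\<bar> < 1 / (2 * 3 ^ D))"
    by (fact block_map_cfrac_small[OF pos, of D k])
  obtain K where K: "\<And>\<nu> \<alpha>. additive_on {..<K} \<nu> \<Longrightarrow>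
    \<exists>\<phi>. block_map {..<K'} {..<K} \<phi> \<and> set_poly D {..<K'} (\<lambda>F. realise \<alpha> \<Phi> (\<nu> (\<phi> F)))"
    by (fact poly_reducibleD[OF assms, of K'])
  show "\<exists>K. \<forall>\<nu> \<alpha>. additive_on {..<K} \<nu> \<longrightarrow> (\<exists>\<phi>. block_map {..<k} {..<K} \<phi> \<and>
    set_poly D {..<k} (\<lambda>F. realise \<alpha> (BFrac \<Phi>) (\<nu> (\<phi> F))))"
  proof (intro exI[of _ K] allI impI)
    fix \<nu> \<alpha> assume "additive_on {..<K} \<nu>"
    from K[OF this] obtain \<phi>\<^sub>1 where 1: "block_map {..<K'} {..<K} \<phi>\<^sub>1"
      "set_poly D {..<K'} (\<lambda>F. realise \<alpha> \<Phi> (\<nu> (\<phi>\<^sub>1 F)))" by blast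
    from K'[OF 1(2)] obtain \<phi>\<^sub>2 where 2: "block_map {..<k} {..<K'} \<phi>\<^sub>2"
      "\<And>J. J \<subseteq> {..<k} \<Longrightarrow> \<bar>cfrac (realise \<alpha> \<Phi> (\<nu> (\<phi>\<^sub>1 (\<phi>\<^sub>2 J))))\<bar> < 1 / (2 * 3 ^ D)" by blast
    from set_poly_cfrac[OF set_poly_block_map[OF 1(2) 2(1)] 2(2)]
    have "set_poly D {..<k} (\<lambda>F. realise \<alpha> (BFrac \<Phi>) (\<nu> (\<phi>\<^sub>1 (\<phi>\<^sub>2 F))))" by simp
    then show "\<exists>\<phi>. block_map {..<k} {..<K} \<phi> \<and>
      set_poly D {..<k} (\<lambda>F. realise \<alpha> (BFrac \<Phi>) (\<nu> (\<phi> F)))"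
      using block_map_comp[OF 2(1) 1(1)] by (intro exI[of _ "\<lambda>F. \<phi>\<^sub>1 (\<phi>\<^sub>2 F)"] conjI) auto
  qed
qed

lemma poly_reducible_BNeg:
  assumes "poly_reducible D \<Phi>"
  shows "poly_reducible D (BNeg \<Phi>)"
proof -
  have neg: "set_poly D A (\<lambda>F. - f F)" if "set_poly D A f" for A f
    using set_poly_cmult[OF that, of "-1"] by simp
  show ?thesis
    unfolding poly_reducible_def realise.simps
  proof
    fix k
    obtain K where K: "\<And>\<nu> \<alpha>. additive_on {..<K} \<nu> \<Longrightarrow>
      \<exists>\<phi>. block_map {..<k} {..<K} \<phi> \<and> set_poly D {..<k} (\<lambda>F. realise \<alpha> \<Phi> (\<nu> (\<phi> F)))"
      by (fact poly_reducibleD[OF assms, of k])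
    show "\<exists>K. \<forall>\<nu> \<alpha>. additive_on {..<K} \<nu> \<longrightarrow> (\<exists>\<phi>. block_map {..<k} {..<K} \<phi> \<and>
      set_poly D {..<k} (\<lambda>F. - realise \<alpha> \<Phi> (\<nu> (\<phi> F))))"
    proof (intro exI[of _ K] allI impI)
      fix \<nu> \<alpha> assume "additive_on {..<K} \<nu>"
      from K[OF this, of \<alpha>] obtain \<phi> where \<phi>: "block_map {..<k} {..<K} \<phi>"
        "set_poly D {..<k} (\<lambda>F. realise \<alpha> \<Phi> (\<nu> (\<phi> F)))" by (elim exE conjE)
      from \<phi>(1) neg[OF \<phi>(2)]
      show "\<exists>\<phi>. block_map {..<k} {..<K} \<phi> \<and>
        set_poly D {..<k} (\<lambda>F. - realise \<alpha> \<Phi> (\<nu> (\<phi> F)))"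
        by (intro exI[of _ \<phi>] conjI)
    qed
  qed
qed

lemma poly_reducible_BMult:
  assumes "poly_reducible D\<^sub>1 \<Phi>\<^sub>1" "poly_reducible D\<^sub>2 \<Phi>\<^sub>2"
  shows "poly_reducible (D\<^sub>1 + D\<^sub>2) (BMult \<Phi>\<^sub>1 \<Phi>\<^sub>2)"
  unfolding poly_reducible_def realise.simps
proof
  fix k
  obtain K where K: "\<And>\<nu> \<alpha>. additive_on {..<K} \<nu> \<Longrightarrow>
    \<exists>\<phi>. block_map {..<k} {..<K} \<phi> \<and> set_poly D\<^sub>1 {..<k} (\<lambda>F. realise \<alpha> \<Phi>\<^sub>1 (\<nu> (\<phi> F))) \<and>
      set_poly D\<^sub>2 {..<k} (\<lambda>F. realise \<alpha> \<Phi>\<^sub>2 (\<nu> (\<phi> F)))"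
    by (fact poly_reducible_pair[OF assms, of k])
  show "\<exists>K. \<forall>\<nu> \<alpha>. additive_on {..<K} \<nu> \<longrightarrow> (\<exists>\<phi>. block_map {..<k} {..<K} \<phi> \<and>
    set_poly (D\<^sub>1 + D\<^sub>2) {..<k} (\<lambda>F. realise \<alpha> \<Phi>\<^sub>1 (\<nu> (\<phi> F)) * realise \<alpha> \<Phi>\<^sub>2 (\<nu> (\<phi> F))))"
  proof (intro exI[of _ K] allI impI)
    fix \<nu> \<alpha> assume "additive_on {..<K} \<nu>"
    from K[OF this, of \<alpha>] obtain \<phi> where \<phi>: "block_map {..<k} {..<K} \<phi>"
      "set_poly D\<^sub>1 {..<k} (\<lambda>F. realise \<alpha> \<Phi>\<^sub>1 (\<nu> (\<phi> F)))"
      "set_poly D\<^sub>2 {..<k} (\<lambda>F. realise \<alpha> \<Phi>\<^sub>2 (\<nu> (\<phi> F)))" by (elim exE conjE)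
    from \<phi>(1) set_poly_mult[OF \<phi>(2,3)]
    show "\<exists>\<phi>. block_map {..<k} {..<K} \<phi> \<and>
      set_poly (D\<^sub>1 + D\<^sub>2) {..<k} (\<lambda>F. realise \<alpha> \<Phi>\<^sub>1 (\<nu> (\<phi> F)) * realise \<alpha> \<Phi>\<^sub>2 (\<nu> (\<phi> F)))"
      by (intro exI[of _ \<phi>] conjI)
  qed
qed

lemma poly_reducible_BAdd:
  assumes "poly_reducible D\<^sub>1 \<Phi>\<^sub>1" "poly_reducible D\<^sub>2 \<Phi>\<^sub>2"
  shows "poly_reducible (max D\<^sub>1 D\<^sub>2) (BAdd \<Phi>\<^sub>1 \<Phi>\<^sub>2)"
proof -
  have add: "set_poly (max D\<^sub>1 D\<^sub>2) A (\<lambda>F. f F + g F)" if "set_poly D\<^sub>1 A f" "set_poly D\<^sub>2 A g" for A f g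
    using set_poly_mono[OF that(1), of "max D\<^sub>1 D\<^sub>2"] set_poly_mono[OF that(2), of "max D\<^sub>1 D\<^sub>2"]
    by (simp add: set_poly_add)
  show ?thesis
    unfolding poly_reducible_def realise.simps
  proof
    fix k
    obtain K where K: "\<And>\<nu> \<alpha>. additive_on {..<K} \<nu> \<Longrightarrow>
      \<exists>\<phi>. block_map {..<k} {..<K} \<phi> \<and> set_poly D\<^sub>1 {..<k} (\<lambda>F. realise \<alpha> \<Phi>\<^sub>1 (\<nu> (\<phi> F))) \<and>
        set_poly D\<^sub>2 {..<k} (\<lambda>F. realise \<alpha> \<Phi>\<^sub>2 (\<nu> (\<phi> F)))"
      by (fact poly_reducible_pair[OF assms, of k])
    show "\<exists>K. \<forall>\<nu> \<alpha>. additive_on {..<K} \<nu> \<longrightarrow> (\<exists>\<phi>. block_map {..<k} {..<K} \<phi> \<and>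
      set_poly (max D\<^sub>1 D\<^sub>2) {..<k} (\<lambda>F. realise \<alpha> \<Phi>\<^sub>1 (\<nu> (\<phi> F)) + realise \<alpha> \<Phi>\<^sub>2 (\<nu> (\<phi> F))))"
    proof (intro exI[of _ K] allI impI)
      fix \<nu> \<alpha> assume "additive_on {..<K} \<nu>"
      from K[OF this, of \<alpha>] obtain \<phi> where \<phi>: "block_map {..<k} {..<K} \<phi>"
        "set_poly D\<^sub>1 {..<k} (\<lambda>F. realise \<alpha> \<Phi>\<^sub>1 (\<nu> (\<phi> F)))"
        "set_poly D\<^sub>2 {..<k} (\<lambda>F. realise \<alpha> \<Phi>\<^sub>2 (\<nu> (\<phi> F)))" by (elim exE conjE)
      from \<phi>(1) add[OF \<phi>(2,3)]
      show "\<exists>\<phi>. block_map {..<k} {..<K} \<phi> \<and>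
        set_poly (max D\<^sub>1 D\<^sub>2) {..<k} (\<lambda>F. realise \<alpha> \<Phi>\<^sub>1 (\<nu> (\<phi> F)) + realise \<alpha> \<Phi>\<^sub>2 (\<nu> (\<phi> F)))"
        by (intro exI[of _ \<phi>] conjI)
    qed
  qed
qed

lemma constant_free_poly_reducible: "constant_free \<Phi> \<Longrightarrow> \<exists>D. poly_reducible D \<Phi>"
proof (induction \<Phi>)
  case (BPoly p)
  then show ?case using poly_reducible_BPoly by blast
next
  case (BNeg \<Phi>)
  then show ?case using poly_reducible_BNeg by auto
next
  case (BFrac \<Phi>)
  then show ?case using poly_reducible_BFrac by auto
next
  case (BMult \<Phi>1 \<Phi>2)
  then show ?case using poly_reducible_BMult by (metis constant_free.simps(4))
next
  case (BAdd \<Phi>1 \<Phi>2)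
  then show ?case using poly_reducible_BAdd by (metis constant_free.simps(5))
qed

text \<open>Each form may be realised with its own values of the symbols, so
  \<open>poly_reducible_pair\<close>, which shares one \<open>\<alpha>\<close>, does not cover this.
  The last form is reduced first, leaving the \<open>K\<close> blocks on which the induction
  hypothesis handles the others.\<close>

lemma simultaneously_poly_reducible:
  fixes \<Theta> :: "nat \<Rightarrow> bracket_form" and r :: nat
  assumes "\<forall>i\<in>{1..r}. constant_free (\<Theta> i)"
  shows "\<exists>D. \<forall>k. \<exists>K. \<forall>\<nu> \<theta>. additive_on {..<K} \<nu> \<longrightarrow> (\<forall>i\<in>{1..r}. is_realisation (\<Theta> i) (\<theta> i)) \<longrightarrow>
    (\<exists>\<phi>. block_map {..<k} {..<K} \<phi> \<and> (\<forall>i\<in>{1..r}. set_poly D {..<k} (\<lambda>F. \<theta> i (\<nu> (\<phi> F)))))"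
  using assms
proof (induction r)
  case 0
  show ?case using block_map_id by auto
next
  case (Suc r)
  then obtain D where D: "\<forall>k. \<exists>K. \<forall>\<nu> \<theta>. additive_on {..<K} \<nu> \<longrightarrow>
    (\<forall>i\<in>{1..r}. is_realisation (\<Theta> i) (\<theta> i)) \<longrightarrow>
    (\<exists>\<phi>. block_map {..<k} {..<K} \<phi> \<and> (\<forall>i\<in>{1..r}. set_poly D {..<k} (\<lambda>F. \<theta> i (\<nu> (\<phi> F)))))"
    by auto
  obtain E where E: "poly_reducible E (\<Theta> (Suc r))"
    using constant_free_poly_reducible Suc.prems by force
  show ?case
  proof (rule exI[of _ "max D E"], rule allI)
    fix k
    from D[rule_format, of k] obtain K where K: "\<forall>\<nu> \<theta>. additive_on {..<K} \<nu> \<longrightarrow>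
      (\<forall>i\<in>{1..r}. is_realisation (\<Theta> i) (\<theta> i)) \<longrightarrow>
      (\<exists>\<phi>. block_map {..<k} {..<K} \<phi> \<and> (\<forall>i\<in>{1..r}. set_poly D {..<k} (\<lambda>F. \<theta> i (\<nu> (\<phi> F)))))" ..
    obtain K' where K': "\<And>\<nu> \<alpha>. additive_on {..<K'} \<nu> \<Longrightarrow>
      \<exists>\<phi>. block_map {..<K} {..<K'} \<phi> \<and> set_poly E {..<K} (\<lambda>F. realise \<alpha> (\<Theta> (Suc r)) (\<nu> (\<phi> F)))"
      by (fact poly_reducibleD[OF E, of K])
    show "\<exists>K. \<forall>\<nu> \<theta>. additive_on {..<K} \<nu> \<longrightarrow> (\<forall>i\<in>{1..Suc r}. is_realisation (\<Theta> i) (\<theta> i)) \<longrightarrow>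
      (\<exists>\<phi>. block_map {..<k} {..<K} \<phi> \<and> (\<forall>i\<in>{1..Suc r}. set_poly (max D E) {..<k} (\<lambda>F. \<theta> i (\<nu> (\<phi> F)))))"
    proof (intro exI[of _ K'] allI impI)
      fix \<nu> and \<theta> :: "nat \<Rightarrow> nat \<Rightarrow> real"
      assume \<nu>: "additive_on {..<K'} \<nu>" and \<theta>: "\<forall>i\<in>{1..Suc r}. is_realisation (\<Theta> i) (\<theta> i)"
      obtain \<alpha> where \<alpha>: "\<theta> (Suc r) = realise \<alpha> (\<Theta> (Suc r))"
        using \<theta> unfolding is_realisation_def by (metis atLeastAtMost_iff le_add1 order_refl plus_1_eq_Suc)
      from K'[OF \<nu>, of \<alpha>] obtain \<phi>\<^sub>1 where 1: "block_map {..<K} {..<K'} \<phi>\<^sub>1"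
        "set_poly E {..<K} (\<lambda>F. \<theta> (Suc r) (\<nu> (\<phi>\<^sub>1 F)))" unfolding \<alpha> by blast
      have "\<exists>\<phi>. block_map {..<k} {..<K} \<phi> \<and> (\<forall>i\<in>{1..r}. set_poly D {..<k} (\<lambda>F. \<theta> i (\<nu> (\<phi>\<^sub>1 (\<phi> F)))))"
        using \<theta> by (intro K[rule_format] additive_on_block_map[OF \<nu> 1(1)]) simp
      then obtain \<phi>\<^sub>2 where 2: "block_map {..<k} {..<K} \<phi>\<^sub>2"
        "\<forall>i\<in>{1..r}. set_poly D {..<k} (\<lambda>F. \<theta> i (\<nu> (\<phi>\<^sub>1 (\<phi>\<^sub>2 F))))" by (elim exE conjE)
      have "set_poly (max D E) {..<k} (\<lambda>F. \<theta> i (\<nu> (\<phi>\<^sub>1 (\<phi>\<^sub>2 F))))" if "i \<in> {1..Suc r}" for i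
      proof (cases "i = Suc r")
        case True
        then show ?thesis
          using set_poly_mono[OF set_poly_block_map[OF 1(2) 2(1)]] by simp
      next
        case False
        then have "i \<in> {1..r}" using that by auto
        then show ?thesis using set_poly_mono[OF 2(2)[rule_format]] by simp
      qed
      then show "\<exists>\<phi>. block_map {..<k} {..<K'} \<phi> \<and>
          (\<forall>i\<in>{1..Suc r}. set_poly (max D E) {..<k} (\<lambda>F. \<theta> i (\<nu> (\<phi> F))))"
        using block_map_comp[OF 2(1) 1(1)] by (intro exI[of _ "\<lambda>F. \<phi>\<^sub>1 (\<phi>\<^sub>2 F)"] conjI) auto
    qed
  qed
qed

section \<open>Density\<close>

text \<open>Reduction is applied to d |F| and followed by recurrence for the resulting set
  functions. The reduction is uniform over additive functions, so the bound on m does not depend on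
  d.\<close>

lemma bounded_dilate_recurrence:
  fixes \<Theta> :: "nat \<Rightarrow> bracket_form" and r :: nat and \<delta> :: real
  assumes "\<forall>i\<in>{1..r}. constant_free (\<Theta> i)" "\<delta> > 0"
  obtains K where "\<And>d \<theta>. (\<And>i. i \<in> {1..r} \<Longrightarrow> is_realisation (\<Theta> i) (\<theta> i)) \<Longrightarrow>
    \<exists>m\<in>{1..K}. \<forall>i\<in>{1..r}. cfrac (\<theta> i (d * m)) \<in> {-\<delta><..<\<delta>}"
proof -
  obtain D where D: "\<forall>k. \<exists>K. \<forall>\<nu> \<theta>. additive_on {..<K} \<nu> \<longrightarrow>
    (\<forall>i\<in>{1..r}. is_realisation (\<Theta> i) (\<theta> i)) \<longrightarrow>
    (\<exists>\<phi>. block_map {..<k} {..<K} \<phi> \<and> (\<forall>i\<in>{1..r}. set_poly D {..<k} (\<lambda>F. \<theta> i (\<nu> (\<phi> F)))))"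
    using simultaneously_poly_reducible[OF assms(1)] by (elim exE)
  obtain k where k: "\<And>A \<F>. finite A \<Longrightarrow> k \<le> card A \<Longrightarrow> finite \<F> \<Longrightarrow> card \<F> \<le> r \<Longrightarrow>
    (\<And>f. f \<in> \<F> \<Longrightarrow> set_poly D A f) \<Longrightarrow> \<exists>B\<subseteq>A. B \<noteq> {} \<and> (\<forall>f\<in>\<F>. \<bar>cfrac (f B)\<bar> < \<delta>)"
    by (fact recurrent_degreeD[OF recurrent_degree[of D] assms(2), of r])
  from D[rule_format, of k] obtain K where K: "\<forall>\<nu> \<theta>. additive_on {..<K} \<nu> \<longrightarrow>
    (\<forall>i\<in>{1..r}. is_realisation (\<Theta> i) (\<theta> i)) \<longrightarrow>
    (\<exists>\<phi>. block_map {..<k} {..<K} \<phi> \<and> (\<forall>i\<in>{1..r}. set_poly D {..<k} (\<lambda>F. \<theta> i (\<nu> (\<phi> F)))))" ..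
  show thesis
  proof (rule that[of K])
    fix d and \<theta> :: "nat \<Rightarrow> nat \<Rightarrow> real"
    assume \<theta>: "\<And>i. i \<in> {1..r} \<Longrightarrow> is_realisation (\<Theta> i) (\<theta> i)"
    have "additive_on {..<K} (\<lambda>F. d * card F)"
      unfolding additive_on_def
    proof (intro allI impI)
      fix F G :: "nat set" assume FG: "F \<subseteq> {..<K}" "G \<subseteq> {..<K}" "F \<inter> G = {}"
      then have "finite F" "finite G" using finite_subset by blast+
      then show "d * card (F \<union> G) = d * card F + d * card G"
        using FG by (simp add: card_Un_disjoint algebra_simps)
    qed
    then have "\<exists>\<phi>. block_map {..<k} {..<K} \<phi> \<and> (\<forall>i\<in>{1..r}. set_poly D {..<k} (\<lambda>F. \<theta> i (d * card (\<phi> F))))"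
      using \<theta> by (rule K[rule_format])
    then obtain \<phi> where \<phi>: "block_map {..<k} {..<K} \<phi>"
      "\<forall>i\<in>{1..r}. set_poly D {..<k} (\<lambda>F. \<theta> i (d * card (\<phi> F)))" by (elim exE conjE)
    have "\<exists>B\<subseteq>{..<k}. B \<noteq> {} \<and> (\<forall>f\<in>(\<lambda>i F. \<theta> i (d * card (\<phi> F))) ` {1..r}. \<bar>cfrac (f B)\<bar> < \<delta>)"
      using \<phi>(2) card_image_le[of "{1..r}" "\<lambda>i F. \<theta> i (d * card (\<phi> F))"] by (intro k) auto
    then obtain B where B: "B \<subseteq> {..<k}" "B \<noteq> {}"
      "\<forall>i\<in>{1..r}. \<bar>cfrac (\<theta> i (d * card (\<phi> B)))\<bar> < \<delta>" by auto
    \<comment> \<open>The multiplier is the size of the union of blocks found: positive because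
      nonempty sets have nonempty images, and at most \<open>K\<close> because the image lies in
      \<open>{..<K}\<close>.\<close>
    have sub: "\<phi> B \<subseteq> {..<K}" and ne: "\<phi> B \<noteq> {}"
      using block_mapD(1,2)[OF \<phi>(1) B(1)] B(2) by auto
    have "card (\<phi> B) \<le> K" using card_mono[OF _ sub] by simp
    moreover have "card (\<phi> B) > 0" using sub ne finite_subset by (auto simp: card_gt_0_iff)
    ultimately have "card (\<phi> B) \<in> {1..K}" by auto
    then show "\<exists>m\<in>{1..K}. \<forall>i\<in>{1..r}. cfrac (\<theta> i (d * m)) \<in> {-\<delta><..<\<delta>}"
      using B(3) by (intro bexI[of _ "card (\<phi> B)"]) (auto simp: abs_less_iff)
  qed
qed

text \<open>Each d from 1 to N div K gives a good number d m(d) in [N]. A good n arises from at most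
  K values of d, one for each possible multiplier, so there are at least (N div K) / K good
  numbers.\<close>

lemma density_of_dilate_recurrence:
  fixes K N :: nat
  assumes "\<And>d. \<exists>m\<in>{1..K}. P (d * m)" "N \<ge> K"
  shows "real (card {n \<in> {1..N}. P n}) \<ge> 1 / (2 * real K ^ 2) * real N"
proof -
  let ?S = "{n \<in> {1..N}. P n}"
  obtain m where m: "\<And>d. m d \<in> {1..K}" "\<And>d. P (d * m d)" using assms(1) by metis
  have K: "K > 0" using m(1)[of 0] by auto
  \<comment> \<open>Recording the multiplier beside the product recovers d by division, as the
    multiplier is positive.\<close>
  have "inj_on (\<lambda>d. (d * m d, m d)) {1..N div K}"
  proof (rule inj_onI)
    fix x y assume "(x * m x, m x) = (y * m y, m y)"
    then show "x = y" using m(1)[of y] by auto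
  qed
  moreover have "(\<lambda>d. (d * m d, m d)) ` {1..N div K} \<subseteq> ?S \<times> {1..K}"
  proof
    fix x assume "x \<in> (\<lambda>d. (d * m d, m d)) ` {1..N div K}"
    then obtain d where d: "d \<in> {1..N div K}" "x = (d * m d, m d)" by blast
    have "d * m d \<le> (N div K) * K" using d m(1)[of d] by (intro mult_le_mono) auto
    also have "\<dots> \<le> N" by simp
    finally have "d * m d \<le> N" .
    moreover have "d * m d \<ge> 1" using d m(1)[of d] by simp
    ultimately show "x \<in> ?S \<times> {1..K}" using d m by auto
  qed
  ultimately have "card {1..N div K} \<le> card (?S \<times> {1..K})"
    by (intro card_inj_on_le) auto
  then have le: "N div K \<le> card ?S * K" by (simp add: card_cartesian_product)
  \<comment> \<open>Once N is at least K, rounding down in N div K loses at most a factor 2, the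
    source of the 2 in the constant.\<close>
  have "N div K \<ge> 1" using K assms(2) by (simp add: Suc_le_eq div_greater_zero_iff)
  then have "K \<le> (N div K) * K" by simp
  moreover have "N mod K < K" using K by simp
  moreover have "N = (N div K) * K + N mod K" by simp
  ultimately have "N \<le> 2 * ((N div K) * K)" by linarith
  also have "\<dots> \<le> 2 * (card ?S * K * K)" using le by simp
  finally have "real N \<le> real (2 * (card ?S * K * K))" by (simp only: of_nat_le_iff)
  then show ?thesis using K by (simp add: field_simps power2_eq_square)
qed

theorem theorem4p10:
  fixes \<Theta> :: "nat \<Rightarrow> bracket_form" and r :: nat and \<delta> :: real
  assumes "\<And>i. i \<in> {1..r} \<Longrightarrow> constant_free (\<Theta> i)"
    and "\<delta> > 0"
  shows "\<exists>(N\<^sub>0::nat) (c::real). c > 0 \<and>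
    (\<forall>N\<ge>N\<^sub>0. \<forall>\<theta> :: nat \<Rightarrow> nat \<Rightarrow> real.
      (\<forall>i\<in>{1..r}. is_realisation (\<Theta> i) (\<theta> i)) \<longrightarrow>
      real (card {n \<in> {1..N}. \<forall>i\<in>{1..r}. cfrac (\<theta> i n) \<in> {-\<delta><..<\<delta>}}) \<ge> c * real N)"
proof -
  have "\<forall>i\<in>{1..r}. constant_free (\<Theta> i)" using assms(1) by blast
  note bounded = bounded_dilate_recurrence[OF this assms(2)]
  obtain K where K: "\<And>d \<theta>. (\<And>i. i \<in> {1..r} \<Longrightarrow> is_realisation (\<Theta> i) (\<theta> i)) \<Longrightarrow>
    \<exists>m\<in>{1..K}. \<forall>i\<in>{1..r}. cfrac (\<theta> i (d * m)) \<in> {-\<delta><..<\<delta>}"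
    by (fact bounded)
  \<comment> \<open>Any instance will do, here d = 0 with all symbols set to 0: a multiplier in
    \<open>{1..K}\<close> exists, so \<open>K\<close> is positive and so is the constant c = 1 / (2
    K^2).\<close>
  have "\<exists>m\<in>{1..K}. \<forall>i\<in>{1..r}. cfrac (realise (\<lambda>_. 0) (\<Theta> i) (0 * m)) \<in> {-\<delta><..<\<delta>}"
    by (rule K) (auto simp: is_realisation_def)
  then have "K > 0" by auto
  then have "1 / (2 * real K ^ 2) > 0" by simp
  then show ?thesis
    using density_of_dilate_recurrence[of K] K
    by (intro exI[of _ K] exI[of _ "1 / (2 * real K ^ 2)"] conjI allI impI) auto
qed

end
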